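(* Let $(P_n)_{n\ge1}$ be i.i.d. random variables in $[0,1]$ and consider the split-merge dynamics with splitting proportions $P_{n,k}=P_n$ for all $1\le k\le n$ (random stratified case), with transformed empirical distributions $\tilde G_n$. Denote by $H$ the distribution of $P_1$ and assume that $H(\{0,1\})<1$. Then, almost surely, as $n\to\infty$, $$\tilde G_n\Rightarrow\tilde g\quad\text{weakly on }[0,1],$$ where $\tilde g$ is the (deterministic) probability measure on $[0,1]$ determined by $H$ as described in the context.
   Context: Given random splitting proportions $(P_{n,k}:n\ge1,\ 1\le k\le n)$ in $[0,1]$, the break points are defined by $A_{n,0}=0$, $A_{n,n+1}=1$ for all $n\ge0$, and recursively for $n\ge1$, $$A_{n,k}=P_{n,k}\,A_{n-1,k-1}+(1-P_{n,k})\,A_{n-1,k},\qquad k=1,\dots,n.$$ The transformed empirical distributions are $\tilde G_n=\frac1n\sum_{k=1}^n\delta_{\tilde A_{n,k}}$ with $\tilde A_{n,k}=A_{n,k}^{1/n}$, for $n\ge1$, where $\delta_a$ is the unit mass at $a$. Definition of $\tilde g$ from $H$: set $\bar p=\int_0^1 t\,H(dt)\in(0,1)$. For $\alpha\in(0,\bar p)$ let $\theta(\alpha)\in\mathbb{R}$ be the unique real $\theta$ with $$\int_0^1\frac{te^{\theta}}{1-t+te^{\theta}}\,H(dt)=\alpha,$$ and define $$I(\alpha)=\alpha\,\theta(\alpha)-\int_0^1\log\bigl(1-t+te^{\theta(\alpha)}\bigr)\,H(dt).$$ The function $I$ is continuous and strictly decreasing on $(0,\bar p)$ with $I(\alpha)\to0$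 as $\alpha\to\bar p$. Put $I(\bar p)=0$, $I(0)=\lim_{\alpha\to0^+}I(\alpha)\in(0,\infty]$ and $x_*=e^{-I(0)}\in[0,1)$. For $x\in[x_*,1]$ let $\alpha_I(x)$ be the unique solution $\alpha\in[0,\bar p]$ of $I(\alpha)=\log(1/x)$ (conventions $e^{-\infty}=0$, $\log(1/0)=\infty$). Then $\tilde g$ is the probability measure on $[0,1]$ with $\tilde g([0,x])=0$ for $x\in[0,x_*]$ and $\tilde g([0,x])=\alpha_I(x)$ for $x\in(x_*,1)$, the remaining mass being at $1$.
   Formalization: If H({1})>0, θ(α) does not exist for α≤H({1}), so g̃ is undefined as described; the left endpoint 0 of the domain of I is replaced by H({1}), and g̃([0,x])=H({1}) for x in [0,x_*] (an atom at 0). For H({1})=0 nothing changes. *)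

theory Defs
  imports "HOL-Probability.Probability"
begin

section \<open>Split-merge dynamics\<close>

text \<open>The recursion acts on \<open>1 \<le> k \<le> n\<close>; the values for \<open>k > n + 1\<close> are irrelevant.\<close>

fun break_pt :: "(nat \<Rightarrow> nat \<Rightarrow> real) \<Rightarrow> nat \<Rightarrow> nat \<Rightarrow> real" where
  "break_pt P 0 k = (if k = 0 then 0 else 1)"
| "break_pt P (Suc n) k =
    (if k = 0 then 0
     else if k \<le> Suc n then
       P (Suc n) k * break_pt P n (k - 1) + (1 - P (Suc n) k) * break_pt P n k
     else 1)"

text \<open>The uniform distribution on the points \<open>A\<^sub>n\<^sub>,\<^sub>k\<close> to the power \<open>1/n\<close>, \<open>1 \<le> k \<le> n\<close>, counted with
  multiplicity (meaningful for \<open>n \<ge> 1\<close>).\<close>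

definition emp_transformed :: "(nat \<Rightarrow> nat \<Rightarrow> real) \<Rightarrow> nat \<Rightarrow> real measure" where
  "emp_transformed P n =
     distr (uniform_count_measure {1..n}) borel (\<lambda>k. root n (break_pt P n k))"


section \<open>The limit law\<close>

text \<open>
  Throughout, \<open>H\<close> is a probability measure on the Borel sets of the real line that is concentrated
  on \<open>[0,1]\<close> with \<open>H {0,1} < 1\<close>.

  As \<open>\<theta>\<close> runs through the real line, \<open>tilted_mean H \<theta>\<close> increases from \<open>H {1}\<close> (excluded), so
  \<open>tilted_mean H \<theta> = \<alpha>\<close> with \<open>\<alpha> \<le> mean_prop H\<close> is solvable exactly for \<open>\<alpha> > H {1}\<close>. The left end
  point of the domain of the rate function is therefore \<open>alpha_min H = H {1}\<close>. If \<open>H\<close> has no atom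
  at 1 this is 0, the rate function lives on \<open>(0, mean_prop H)\<close>, and the limit law has no mass in
  \<open>[0, x_star H]\<close>. If \<open>H {1} > 0\<close>, asymptotically a fraction \<open>H {1}\<close> of the break points is
  exactly 0, and the limit law has an atom of that mass at 0.
\<close>

definition mean_prop :: "real measure \<Rightarrow> real" where
  "mean_prop H = (LINT t:{0..1}|H. t)"

definition alpha_min :: "real measure \<Rightarrow> real" where
  "alpha_min H = measure H {1}"

definition tilted_mean :: "real measure \<Rightarrow> real \<Rightarrow> real" where
  "tilted_mean H \<theta> = (LINT t:{0..1}|H. t * exp \<theta> / (1 - t + t * exp \<theta>))"

definition tilt :: "real measure \<Rightarrow> real \<Rightarrow> real" where
  "tilt H \<alpha> = (THE \<theta>. tilted_mean H \<theta> = \<alpha>)"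

text \<open>The rate function on the open interval \<open>(alpha_min H, mean_prop H)\<close>, \<dots>\<close>

definition rate_int :: "real measure \<Rightarrow> real \<Rightarrow> real" where
  "rate_int H \<alpha> = \<alpha> * tilt H \<alpha> - (LINT t:{0..1}|H. ln (1 - t + t * exp (tilt H \<alpha>)))"

text \<open>\<dots> and its extension to the closed interval, possibly infinite at the left end point.\<close>

definition rate :: "real measure \<Rightarrow> real \<Rightarrow> ereal" where
  "rate H \<alpha> =
     (if \<alpha> = mean_prop H then 0
      else if \<alpha> = alpha_min H then Lim (at_right (alpha_min H)) (\<lambda>a. ereal (rate_int H a))
      else ereal (rate_int H \<alpha>))"

definition x_star :: "real measure \<Rightarrow> real" where
  "x_star H = (if rate H (alpha_min H) = \<infinity> then 0
               else exp (- real_of_ereal (rate H (alpha_min H))))"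

definition log_recip :: "real \<Rightarrow> ereal" where
  "log_recip x = (if x = 0 then \<infinity> else ereal (ln (1 / x)))"

definition alpha_I :: "real measure \<Rightarrow> real \<Rightarrow> real" where
  "alpha_I H x = (THE \<alpha>. \<alpha> \<in> {alpha_min H..mean_prop H} \<and> rate H \<alpha> = log_recip x)"

definition g_cdf :: "real measure \<Rightarrow> real \<Rightarrow> real" where
  "g_cdf H x =
     (if x < 0 then 0
      else if x \<le> x_star H then alpha_min H
      else if x < 1 then alpha_I H x
      else 1)"

definition g_tilde :: "real measure \<Rightarrow> real measure" where
  "g_tilde H = interval_measure (g_cdf H)"

end

theory Submission
  imports Defs
begin

text \<open>
  If \<open>P\<^sub>n\<^sub>,\<^sub>k = P\<^sub>n\<close> for all \<open>k\<close>, the recursion for the break points is that of a random walk: given the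
  proportions, \<open>A\<^sub>n\<^sub>,\<^sub>k = Pr (S\<^sub>n < k)\<close> for a sum \<open>S\<^sub>n\<close> of independent Bernoulli variables with success
  probabilities \<open>P\<^sub>1, \<dots>, P\<^sub>n\<close> (\<open>break_pt_eq_walk_mean\<close>). The \<open>n\<close>-th root of \<open>A\<^sub>n\<^sub>,\<^sub>k\<close> at \<open>k \<approx> \<alpha> n\<close> is
  therefore governed by the lower large deviations of \<open>S\<^sub>n\<close>: for \<open>\<alpha> \<noteq> H {1}\<close> it converges to
  \<open>exp (- I \<alpha>)\<close>, where \<open>I\<close> is read as \<open>\<infinity>\<close> to the left of \<open>H {1}\<close> and as 0 to the right of the mean
  of \<open>H\<close>. The limit law is the image of the uniform distribution of \<open>\<alpha> \<in> [0, 1]\<close> under this map.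

  The large deviation bounds are the classical ones, in a form valid for every \<open>n\<close>: the exponential Markov
  inequality from above (\<open>break_pt_upper\<close>), and tilting by \<open>exp (\<theta> S\<^sub>n)\<close> with \<open>\<theta> < 0\<close> followed by
  Chebyshev's inequality from below (\<open>break_pt_lower\<close>). They involve the proportions only through averages
  of \<open>bern_cgf \<theta> (P\<^sub>i)\<close> and \<open>bern_tilt \<theta> (P\<^sub>i)\<close>. These are averages of bounded i.i.d. variables, so they
  converge almost surely (\<open>slln_bounded\<close>) to \<open>mean_cgf \<theta>\<close> and \<open>tilted_mean H \<theta>\<close>. For each level \<open>x\<close> only
  strict inequalities between the limits have to be met, and these can be met with rational \<open>\<theta>\<close>; hence a
  single null set serves all \<open>x\<close>.

  On the analytic side the rate function is used in the parametric form
  \<open>legendre \<theta> = I (tilted_mean H \<theta>)\<close>. The tangent line inequality for \<open>mean_cgf\<close> makes it strictly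
  decreasing in \<open>\<theta> < 0\<close>. Thus for \<open>0 \<le> x < 1\<close> the value \<open>g_cdf H x\<close> is the infimum of
  \<open>tilted_mean H \<theta>\<close> over all \<open>\<theta> < 0\<close> with \<open>x < exp (- legendre \<theta>)\<close> (\<open>g_cdf_le_tilted_mean\<close>,
  \<open>tilted_mean_near_g_cdf\<close>). That \<open>g_cdf\<close> is a distribution function and that it bounds the empirical
  distribution functions asymptotically from above both follow from this; the opposite bound comes from
  \<open>chernoff_exponent_below\<close>. Continuity points suffice for weak convergence, which matters at \<open>x = 0\<close>, where
  \<open>g_cdf\<close> may jump.
\<close>

section \<open>Exponential tilting of Bernoulli distributions\<close>

text \<open>
  The Bernoulli distribution with success probability \<open>t\<close>, reweighted by \<open>exp (\<theta> j)\<close> and normalised,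
  has success probability \<open>bern_tilt \<theta> t\<close>; the logarithm of the normalising constant is \<open>bern_cgf \<theta> t\<close>,
  its cumulant generating function.
\<close>

definition bern_tilt :: "real \<Rightarrow> real \<Rightarrow> real" where
  "bern_tilt \<theta> t = t * exp \<theta> / (1 - t + t * exp \<theta>)"

definition bern_cgf :: "real \<Rightarrow> real \<Rightarrow> real" where
  "bern_cgf \<theta> t = ln (1 - t + t * exp \<theta>)"

lemma bern_mgf_pos:
  fixes t \<theta> :: real
  assumes "t \<in> {0..1}"
  shows "1 - t + t * exp \<theta> > 0"
proof (cases "t = 1")
  case False
  then show ?thesis using assms by (intro add_pos_nonneg) auto
qed simp

lemma bern_tilt_range:
  assumes "t \<in> {0..1}"
  shows "bern_tilt \<theta> t \<in> {0..1}"
  using bern_mgf_pos[OF assms, of \<theta>] assms by (auto simp: bern_tilt_def)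

lemma bern_tilt_bound: "t \<in> {0..1} \<Longrightarrow> \<bar>bern_tilt \<theta> t\<bar> \<le> 1"
  using bern_tilt_range[of t \<theta>] by simp

lemma bern_tilt_0: "bern_tilt 0 t = t"
  by (simp add: bern_tilt_def)

lemma bern_cgf_0: "bern_cgf 0 t = 0"
  by (simp add: bern_cgf_def)

lemma bern_tilt_1: "bern_tilt \<theta> 1 = 1"
  by (simp add: bern_tilt_def)

lemma bern_cgf_1: "bern_cgf \<theta> 1 = \<theta>"
  by (simp add: bern_cgf_def)

lemma bern_tilt_measurable [measurable]: "bern_tilt \<theta> \<in> borel_measurable borel"
  unfolding bern_tilt_def by measurable

lemma bern_cgf_measurable [measurable]: "bern_cgf \<theta> \<in> borel_measurable borel"
  unfolding bern_cgf_def by measurable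

lemma bern_tilt_mono:
  assumes "t \<in> {0..1}" "\<theta> \<le> \<eta>"
  shows "bern_tilt \<theta> t \<le> bern_tilt \<eta> t"
proof -
  have "t * (1 - t) * exp \<theta> \<le> t * (1 - t) * exp \<eta>"
    using assms by (intro mult_left_mono) auto
  then show ?thesis
    using bern_mgf_pos[OF assms(1), of \<theta>] bern_mgf_pos[OF assms(1), of \<eta>]
    by (simp add: bern_tilt_def divide_simps) (simp add: algebra_simps)
qed

lemma bern_tilt_strict_mono:
  assumes "t \<in> {0<..<1}" "\<theta> < \<eta>"
  shows "bern_tilt \<theta> t < bern_tilt \<eta> t"
proof -
  have "t * (1 - t) * exp \<theta> < t * (1 - t) * exp \<eta>"
    using assms by (intro mult_strict_left_mono) auto
  moreover have "t \<in> {0..1}" using assms by auto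
  ultimately show ?thesis
    using bern_mgf_pos[of t \<theta>] bern_mgf_pos[of t \<eta>]
    by (simp add: bern_tilt_def divide_simps) (simp add: algebra_simps)
qed

text \<open>
  The cumulant generating function is convex in \<open>\<theta>\<close> with slope \<open>bern_tilt \<theta> t\<close>. This needs no derivative:
  the quotient of the moment generating functions at \<open>\<eta>\<close> and \<open>\<theta>\<close> is that of the tilted distribution at
  \<open>\<eta> - \<theta>\<close>, so the tangent line inequality is Jensen's inequality for \<open>exp\<close>.
\<close>

lemma bern_cgf_tangent:
  assumes t: "t \<in> {0..1}"
  shows "bern_tilt \<theta> t * (\<eta> - \<theta>) \<le> bern_cgf \<eta> t - bern_cgf \<theta> t"
proof -
  define q where "q = bern_tilt \<theta> t"
  have q: "q \<in> {0..1}" unfolding q_def by (rule bern_tilt_range[OF t])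
  note pos = bern_mgf_pos[OF t, of \<theta>] bern_mgf_pos[OF t, of \<eta>]
  have "exp ((1 - q) *\<^sub>R 0 + q *\<^sub>R (\<eta> - \<theta>)) \<le> (1 - q) * exp 0 + q * exp (\<eta> - \<theta>)"
    using q by (intro convex_onD[OF exp_convex]) auto
  also have "\<dots> = (1 - t + t * exp \<eta>) / (1 - t + t * exp \<theta>)"
    using pos by (simp add: q_def bern_tilt_def exp_diff divide_simps)
  finally have "q * (\<eta> - \<theta>) \<le> ln ((1 - t + t * exp \<eta>) / (1 - t + t * exp \<theta>))"
    using pos by (subst ln_ge_iff) auto
  also have "\<dots> = bern_cgf \<eta> t - bern_cgf \<theta> t"
    using pos by (simp add: bern_cgf_def ln_div)
  finally show ?thesis by (simp add: q_def)
qed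

lemma bern_cgf_bound:
  assumes t: "t \<in> {0..1}"
  shows "\<bar>bern_cgf \<theta> t\<bar> \<le> \<bar>\<theta>\<bar>"
proof -
  have "t * \<theta> \<le> bern_cgf \<theta> t" "bern_cgf \<theta> t \<le> bern_tilt \<theta> t * \<theta>"
    using bern_cgf_tangent[OF t, of 0 \<theta>] bern_cgf_tangent[OF t, of \<theta> 0]
    by (simp_all add: bern_tilt_0 bern_cgf_0)
  moreover have "\<bar>t * \<theta>\<bar> \<le> 1 * \<bar>\<theta>\<bar>" "\<bar>bern_tilt \<theta> t * \<theta>\<bar> \<le> 1 * \<bar>\<theta>\<bar>"
    unfolding abs_mult using t bern_tilt_range[OF t, of \<theta>]
    by (intro mult_right_mono; simp)+
  ultimately show ?thesis by linarith
qed

text \<open>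
  As \<open>\<theta> \<rightarrow> -\<infinity>\<close>, only a deterministic upward step (\<open>t = 1\<close>) keeps paying the full price \<open>\<theta>\<close>. After
  integration this bound shows that an atom of the proportions at 1 forces the corresponding fraction of the
  transformed break points to 0.
\<close>

lemma bern_cgf_le:
  assumes t: "t \<in> {0..1}" and "\<theta> \<le> 0"
  shows "bern_cgf \<theta> t \<le> \<theta> * indicator {1} t"
proof (cases "t = 1")
  case False
  have "t * exp \<theta> \<le> t * 1" using assms by (intro mult_left_mono) auto
  then have "bern_cgf \<theta> t \<le> 0"
    using bern_mgf_pos[OF t, of \<theta>] by (simp add: bern_cgf_def)
  then show ?thesis using False by simp
qed (simp add: bern_cgf_1)

section \<open>Break points as probabilities of a random walk\<close>

text \<open>
  The expectation of \<open>f (S\<^sub>n)\<close>, where \<open>S\<^sub>n\<close> is a sum of independent Bernoulli variables with success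
  probabilities \<open>p 1, \<dots>, p n\<close>. Conditioning on the last step gives the recursion; in this form facts about
  the law of \<open>S\<^sub>n\<close> are inductions on \<open>n\<close> for arbitrary \<open>f\<close>, without sums over the values of \<open>S\<^sub>n\<close>.
\<close>

fun walk_mean :: "(nat \<Rightarrow> real) \<Rightarrow> nat \<Rightarrow> (nat \<Rightarrow> real) \<Rightarrow> real" where
  "walk_mean p 0 f = f 0"
| "walk_mean p (Suc n) f =
     p (Suc n) * walk_mean p n (\<lambda>j. f (Suc j)) + (1 - p (Suc n)) * walk_mean p n f"

text \<open>
  The split-merge recursion with a common proportion per level is the recursion for \<open>Pr (S\<^sub>n < k)\<close>. The
  boundary values 0 and 1 agree with it because \<open>0 \<le> S\<^sub>n \<le> n\<close>.
\<close>

lemma break_pt_eq_walk_mean: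
  "break_pt (\<lambda>n k. p n) n k = walk_mean p n (\<lambda>j. of_bool (j < k))"
proof (induction n arbitrary: k)
  case 0
  show ?case by simp
next
  case (Suc n)
  have one: "break_pt (\<lambda>n k. p n) n k = 1" if "n < k" for k
    using that by (cases n) auto
  have shift: "walk_mean p n (\<lambda>j. of_bool (Suc j < k)) = break_pt (\<lambda>n k. p n) n (k - 1)"
    unfolding Suc.IH by (intro arg_cong[of _ _ "walk_mean p n"] ext) auto
  have zero: "break_pt (\<lambda>n k. p n) n 0 = 0"
    by (cases n) auto
  have "walk_mean p (Suc n) (\<lambda>j. of_bool (j < k)) =
          p (Suc n) * break_pt (\<lambda>n k. p n) n (k - 1) + (1 - p (Suc n)) * break_pt (\<lambda>n k. p n) n k"
    by (simp add: shift Suc.IH)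
  moreover have "break_pt (\<lambda>n k. p n) n (k - 1) = 1 \<and> break_pt (\<lambda>n k. p n) n k = 1" if "k > Suc n"
    using that one by auto
  ultimately show ?case by (auto simp: zero)
qed

lemma walk_mean_mono:
  assumes "\<And>i. i \<in> {1..n} \<Longrightarrow> p i \<in> {0..1}" and "\<And>j. f j \<le> g j"
  shows "walk_mean p n f \<le> walk_mean p n g"
  using assms
proof (induction n arbitrary: f g)
  case (Suc n)
  have "p (Suc n) \<in> {0..1}" using Suc.prems(1) by auto
  then show ?case
    using Suc.IH[OF Suc.prems(1) Suc.prems(2)]
      Suc.IH[OF Suc.prems(1), of "\<lambda>j. f (Suc j)" "\<lambda>j. g (Suc j)"] Suc.prems(2)
    by (auto intro!: add_mono mult_left_mono)
qed simp

lemma walk_mean_cmult: "walk_mean p n (\<lambda>j. c * f j) = c * walk_mean p n f"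
  by (induction n arbitrary: f) (auto simp: algebra_simps)

lemma walk_mean_const: "walk_mean p n (\<lambda>j. c) = c"
  by (induction n) (auto simp: algebra_simps)

lemma walk_mean_diff: "walk_mean p n (\<lambda>j. f j - g j) = walk_mean p n f - walk_mean p n g"
proof (induction n arbitrary: f g)
  case (Suc n)
  show ?case unfolding walk_mean.simps Suc.IH by (simp add: algebra_simps)
qed simp

text \<open>
  Variance plus squared bias. The centre \<open>c\<close> is arbitrary so that an upward step can be absorbed by moving it.
\<close>

lemma walk_mean_square:
  "walk_mean p n (\<lambda>j. (real j - c)\<^sup>2) =
     (\<Sum>i=1..n. p i * (1 - p i)) + ((\<Sum>i=1..n. p i) - c)\<^sup>2"
proof (induction n arbitrary: c)
  case (Suc n)
  have "(\<lambda>j. (real (Suc j) - c)\<^sup>2) = (\<lambda>j. (real j - (c - 1))\<^sup>2)"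
    by (auto simp: algebra_simps)
  then have "walk_mean p (Suc n) (\<lambda>j. (real j - c)\<^sup>2) =
      p (Suc n) * walk_mean p n (\<lambda>j. (real j - (c - 1))\<^sup>2)
      + (1 - p (Suc n)) * walk_mean p n (\<lambda>j. (real j - c)\<^sup>2)"
    by simp
  also have "\<dots> = (\<Sum>i=1..Suc n. p i * (1 - p i)) + ((\<Sum>i=1..Suc n. p i) - c)\<^sup>2"
    unfolding Suc.IH by (simp add: algebra_simps power2_eq_square)
  finally show ?case .
qed simp

text \<open>
  Exponential change of measure: since the steps are independent, the weight \<open>exp (\<theta> S\<^sub>n)\<close> tilts each
  step separately.
\<close>

lemma walk_mean_tilt:
  assumes "\<And>i. i \<in> {1..n} \<Longrightarrow> p i \<in> {0..1}"
  shows "walk_mean p n (\<lambda>j. exp (\<theta> * real j) * f j) =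
         exp (\<Sum>i=1..n. bern_cgf \<theta> (p i)) * walk_mean (\<lambda>i. bern_tilt \<theta> (p i)) n f"
  using assms
proof (induction n arbitrary: f)
  case (Suc n)
  define q where "q = p (Suc n)"
  define D where "D = 1 - q + q * exp \<theta>"
  have D: "D > 0"
    unfolding D_def q_def using Suc.prems by (intro bern_mgf_pos) auto
  let ?E = "walk_mean (\<lambda>i. bern_tilt \<theta> (p i)) n"
  let ?F = "exp (\<Sum>i=1..n. bern_cgf \<theta> (p i))"
  have ih: "walk_mean p n (\<lambda>j. exp (\<theta> * real j) * g j) = ?F * ?E g" for g
    by (rule Suc.IH) (use Suc.prems in auto)
  have t: "D * bern_tilt \<theta> q = q * exp \<theta>"  "D * (1 - bern_tilt \<theta> q) = 1 - q"
    using D by (simp_all add: bern_tilt_def flip: D_def) (simp add: D_def field_simps)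
  have e: "exp (\<Sum>i=1..Suc n. bern_cgf \<theta> (p i)) = D * ?F"
    using D by (simp add: exp_add bern_cgf_def D_def q_def)
  have "walk_mean p (Suc n) (\<lambda>j. exp (\<theta> * real j) * f j) =
      q * walk_mean p n (\<lambda>j. exp \<theta> * (exp (\<theta> * real j) * f (Suc j)))
      + (1 - q) * walk_mean p n (\<lambda>j. exp (\<theta> * real j) * f j)"
    by (simp add: q_def exp_add algebra_simps)
  also have "\<dots> = q * exp \<theta> * (?F * ?E (\<lambda>j. f (Suc j))) + (1 - q) * (?F * ?E f)"
    by (simp add: walk_mean_cmult ih)
  also have "\<dots> = (D * bern_tilt \<theta> q) * (?F * ?E (\<lambda>j. f (Suc j))) + (D * (1 - bern_tilt \<theta> q)) * (?F * ?E f)"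
    by (simp only: t)
  also have "\<dots> = (D * ?F) * (bern_tilt \<theta> q * ?E (\<lambda>j. f (Suc j)) + (1 - bern_tilt \<theta> q) * ?E f)"
    by (simp add: algebra_simps)
  finally show ?case
    unfolding e by (simp add: q_def)
qed simp

text \<open>
  The exponential Markov inequality: \<open>exp (\<theta> (j - k))\<close> dominates the indicator of \<open>j < k\<close>, as \<open>\<theta> \<le> 0\<close>.
\<close>

lemma break_pt_upper:
  assumes p: "\<And>i. i \<in> {1..n} \<Longrightarrow> p i \<in> {0..1}" and "\<theta> \<le> 0"
  shows "break_pt (\<lambda>n k. p n) n k \<le> exp ((\<Sum>i=1..n. bern_cgf \<theta> (p i)) - \<theta> * real k)"
proof -
  have "break_pt (\<lambda>n k. p n) n k \<le> walk_mean p n (\<lambda>j. exp (\<theta> * real j) * exp (- \<theta> * real k))"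
    unfolding break_pt_eq_walk_mean
  proof (rule walk_mean_mono[OF p])
    fix j
    have "\<theta> * real k \<le> \<theta> * real j" if "j < k"
      using that \<open>\<theta> \<le> 0\<close> by (intro mult_left_mono_neg) auto
    then show "of_bool (j < k) \<le> exp (\<theta> * real j) * exp (- \<theta> * real k)"
      by (auto simp flip: exp_add)
  qed
  also have "\<dots> = exp ((\<Sum>i=1..n. bern_cgf \<theta> (p i)) - \<theta> * real k)"
    by (subst walk_mean_tilt[OF p]) (simp_all add: walk_mean_const flip: exp_add)
  finally show ?thesis .
qed

text \<open>
  Under the tilted walk, \<open>S\<^sub>n\<close> lies within \<open>\<delta> n\<close> of its mean \<open>m\<close> except with probability at most
  \<open>1 / (\<delta>\<^sup>2 n)\<close>, by Chebyshev's inequality. There \<open>S\<^sub>n < k\<close>, and the density that undoes the tilt is at least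
  the normalising constant times \<open>exp (- \<theta> (m - \<delta> n))\<close>, because \<open>\<theta> \<le> 0\<close>.
\<close>

lemma break_pt_lower:
  assumes p: "\<And>i. i \<in> {1..n} \<Longrightarrow> p i \<in> {0..1}" and "\<theta> \<le> 0" "\<delta> > 0" "n \<ge> 1"
    and k: "(\<Sum>i=1..n. bern_tilt \<theta> (p i)) + \<delta> * real n \<le> real k"
  shows "break_pt (\<lambda>n k. p n) n k \<ge>
           exp ((\<Sum>i=1..n. bern_cgf \<theta> (p i)) - \<theta> * ((\<Sum>i=1..n. bern_tilt \<theta> (p i)) - \<delta> * real n))
             * (1 - 1 / (\<delta>\<^sup>2 * real n))"
proof -
  define m where "m = (\<Sum>i=1..n. bern_tilt \<theta> (p i))"
  define q where "q = (\<lambda>i. bern_tilt \<theta> (p i))"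
  define r where "r = \<delta> * real n"
  define F where "F = exp (\<Sum>i=1..n. bern_cgf \<theta> (p i))"
  have q: "q i \<in> {0..1}" if "i \<in> {1..n}" for i
    unfolding q_def using p[OF that] by (rule bern_tilt_range)
  have r: "r > 0" using assms by (simp add: r_def)
  have "walk_mean q n (\<lambda>j. (real j - m)\<^sup>2) = (\<Sum>i=1..n. q i * (1 - q i))"
    by (simp add: walk_mean_square m_def q_def)
  also have "\<dots> \<le> (\<Sum>i=1..n. 1)"
    using q by (intro sum_mono) (auto intro!: mult_le_one)
  finally have var: "walk_mean q n (\<lambda>j. (real j - m)\<^sup>2) \<le> real n" by simp
  have "1 / (\<delta>\<^sup>2 * real n) = real n / r\<^sup>2"
    using assms by (simp add: r_def power2_eq_square field_simps)
  then have "1 - 1 / (\<delta>\<^sup>2 * real n) \<le> 1 - walk_mean q n (\<lambda>j. (real j - m)\<^sup>2) / r\<^sup>2"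
    using var by (simp add: divide_right_mono)
  also have "\<dots> = walk_mean q n (\<lambda>j. 1 - (1 / r\<^sup>2) * (real j - m)\<^sup>2)"
    unfolding walk_mean_diff walk_mean_cmult walk_mean_const by simp
  finally have "F * exp (- \<theta> * (m - r)) * (1 - 1 / (\<delta>\<^sup>2 * real n)) \<le>
     F * exp (- \<theta> * (m - r)) * walk_mean q n (\<lambda>j. 1 - (1 / r\<^sup>2) * (real j - m)\<^sup>2)"
    by (intro mult_left_mono) (auto simp: F_def)
  also have "\<dots> = F * walk_mean q n (\<lambda>j. exp (- \<theta> * (m - r)) * (1 - (1 / r\<^sup>2) * (real j - m)\<^sup>2))"
    by (simp add: walk_mean_cmult)
  also have "\<dots> \<le> F * walk_mean q n (\<lambda>j. exp (- \<theta> * real j) * of_bool (j < k))"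
  proof (intro mult_left_mono walk_mean_mono q)
    fix j
    \<comment> \<open>the parabola \<open>1 - (j - m)\<^sup>2 / r\<^sup>2\<close> lies below the indicator of \<open>\<bar>j - m\<bar> < r\<close>; its expectation needs
        only the variance\<close>
    show "exp (- \<theta> * (m - r)) * (1 - (1 / r\<^sup>2) * (real j - m)\<^sup>2) \<le> exp (- \<theta> * real j) * of_bool (j < k)"
    proof (cases "\<bar>real j - m\<bar> < r")
      case True
      then have "real j < real k" using k by (auto simp: m_def r_def)
      then have "j < k" by simp
      have "exp (- \<theta> * (m - r)) * (1 - (1 / r\<^sup>2) * (real j - m)\<^sup>2) \<le> exp (- \<theta> * (m - r)) * 1"
        by (intro mult_left_mono) auto
      also have "\<dots> \<le> exp (- \<theta> * real j) * 1"
        using True \<open>\<theta> \<le> 0\<close> by (auto intro!: mult_left_mono_neg)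
      finally show ?thesis using \<open>j < k\<close> by simp
    next
      case False
      then have "r\<^sup>2 \<le> (real j - m)\<^sup>2"
        using r by (metis abs_le_square_iff abs_of_pos not_less)
      then have "1 - (1 / r\<^sup>2) * (real j - m)\<^sup>2 \<le> 0"
        using r by (simp add: field_simps)
      then have "exp (- \<theta> * (m - r)) * (1 - (1 / r\<^sup>2) * (real j - m)\<^sup>2) \<le> 0"
        by (intro mult_nonneg_nonpos) auto
      also have "0 \<le> exp (- \<theta> * real j) * of_bool (j < k)" by simp
      finally show ?thesis .
    qed
  qed (auto simp: F_def)
  also have "\<dots> = walk_mean p n (\<lambda>j. exp (\<theta> * real j) * (exp (- \<theta> * real j) * of_bool (j < k)))"
    by (subst walk_mean_tilt[OF p]) (simp_all add: F_def q_def)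
  also have "\<dots> = break_pt (\<lambda>n k. p n) n k"
    unfolding break_pt_eq_walk_mean by (simp flip: mult.assoc exp_add)
  finally show ?thesis
    by (simp add: F_def m_def r_def algebra_simps flip: exp_add)
qed

lemma break_pt_range:
  assumes p: "\<And>i. i \<ge> 1 \<Longrightarrow> p i \<in> {0..1}"
  shows "break_pt (\<lambda>n k. p n) n k \<in> {0..1}"
proof -
  have "walk_mean p n (\<lambda>_. 0) \<le> break_pt (\<lambda>n k. p n) n k"
       "break_pt (\<lambda>n k. p n) n k \<le> walk_mean p n (\<lambda>_. 1)"
    unfolding break_pt_eq_walk_mean using p by (auto intro!: walk_mean_mono)
  then show ?thesis by (simp add: walk_mean_const)
qed

section \<open>A strong law of large numbers for bounded variables\<close>

text \<open>
  By Hoeffding's inequality the probability that the average deviates by more than a fixed amount decays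
  geometrically in \<open>n\<close>, so the Borel-Cantelli lemma applies to each of countably many tolerances.
\<close>

lemma (in prob_space) slln_bounded:
  fixes X :: "nat \<Rightarrow> 'a \<Rightarrow> real"
  assumes indep: "indep_vars (\<lambda>_. borel) X {1..}"
    and ident: "\<And>i. i \<ge> 1 \<Longrightarrow> distr M borel (X i) = distr M borel (X 1)"
    and bounded: "AE \<omega> in M. X 1 \<omega> \<in> {a..b}"
  shows "AE \<omega> in M. (\<lambda>n. (\<Sum>i=1..n. X i \<omega>) / real n) \<longlonglongrightarrow> expectation (X 1)"
proof -
  define \<mu> where "\<mu> = expectation (X 1)"
  \<comment> \<open>enlarging the interval keeps its length positive, as Hoeffding's inequality requires\<close>
  define d where "d = \<bar>b - a\<bar> + 1"
  have rv [measurable]: "random_variable borel (X i)" if "i \<ge> 1" for i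
    using indep that unfolding indep_vars_def by auto
  have bound: "AE \<omega> in M. X 1 \<omega> \<in> {a..a + d}"
    using bounded by eventually_elim (auto simp: d_def)
  define A where "A e n = {\<omega> \<in> space M. \<bar>(\<Sum>i=1..n. X i \<omega>) / real n - \<mu>\<bar> \<ge> e}" for e n
  have A_sets: "A e n \<in> events" for e n
    unfolding A_def by measurable
  have A_prob: "prob (A e n) \<le> 2 * exp (- 2 * e\<^sup>2 / d\<^sup>2) ^ n" if "e > 0" for e n
  proof (cases "n = 0")
    case True
    then show ?thesis by (simp add: order_trans[OF prob_le_1])
  next
    case False
    interpret H: Hoeffding_ineq_iid M "{1..n}" X "X 1" a "a + d" \<mu>
    proof unfold_locales
      show "indep_vars (\<lambda>_. borel) X {1..n}"
        using indep by (rule indep_vars_subset) auto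
      show "distr M borel (X i) = distr M borel (X 1)" if "i \<in> {1..n}" for i
        using that by (intro ident) auto
    qed (use bound in \<open>auto simp: \<mu>_def\<close>)
    have "prob (A e n) \<le> 2 * exp (- 2 * real n * e\<^sup>2 / d\<^sup>2)"
      using H.Hoeffding_ineq_abs_ge'[of e] False \<open>e > 0\<close> by (simp add: A_def d_def)
    also have "- 2 * real n * e\<^sup>2 / d\<^sup>2 = real n * (- 2 * e\<^sup>2 / d\<^sup>2)"
      by simp
    finally show ?thesis unfolding exp_of_nat_mult .
  qed
  have "AE \<omega> in M. eventually (\<lambda>n. \<omega> \<in> space M - A e n) sequentially" if "e > 0" for e
  proof (rule borel_cantelli_AE1[OF A_sets])
    have "d > 0" by (simp add: d_def)
    then have "exp (- 2 * e\<^sup>2 / d\<^sup>2) < 1" using that by simp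
    then have "summable (\<lambda>n. 2 * exp (- 2 * e\<^sup>2 / d\<^sup>2) ^ n)"
      by (intro summable_mult summable_geometric) simp
    then show "summable (\<lambda>n. prob (A e n))"
      by (rule summable_comparison_test'[where N = 0]) (use A_prob[OF that] in auto)
  qed (simp add: emeasure_eq_measure)
  then have "AE \<omega> in M. \<forall>m. eventually (\<lambda>n. \<omega> \<in> space M - A (1 / real (Suc m)) n) sequentially"
    unfolding AE_all_countable by simp
  then show ?thesis
  proof eventually_elim
    case (elim \<omega>)
    show ?case unfolding \<mu>_def[symmetric]
    proof (rule LIMSEQ_I)
      fix r :: real assume "r > 0"
      then obtain m where m: "1 / real (Suc m) < r"
        using nat_approx_posE by blast
      obtain N where N: "\<And>n. n \<ge> N \<Longrightarrow> \<omega> \<in> space M - A (1 / real (Suc m)) n"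
        using elim unfolding eventually_sequentially by meson
      have "norm ((\<Sum>i=1..n. X i \<omega>) / real n - \<mu>) < r" if "n \<ge> N" for n
        using N[OF that] m by (auto simp: A_def not_le)
      then show "\<exists>N. \<forall>n\<ge>N. norm ((\<Sum>i=1..n. X i \<omega>) / real n - \<mu>) < r"
        by blast
    qed
  qed
qed

lemma (in prob_space) iid_average_bounded:
  fixes P :: "nat \<Rightarrow> 'a \<Rightarrow> real" and f :: "real \<Rightarrow> real"
  assumes range: "\<And>n \<omega>. n \<ge> 1 \<Longrightarrow> \<omega> \<in> space M \<Longrightarrow> P n \<omega> \<in> {0..1}"
    and indep: "indep_vars (\<lambda>_. borel) P {1..}"
    and ident: "\<And>n. n \<ge> 1 \<Longrightarrow> distr M borel (P n) = H"
    and f [measurable]: "f \<in> borel_measurable borel" and bound: "\<And>t. t \<in> {0..1} \<Longrightarrow> \<bar>f t\<bar> \<le> B"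
  shows "AE \<omega> in M. (\<lambda>n. (\<Sum>i=1..n. f (P i \<omega>)) / real n) \<longlonglongrightarrow> (LINT t:{0..1}|H. f t)"
proof -
  have rv [measurable]: "random_variable borel (P i)" if "i \<ge> 1" for i
    using indep that unfolding indep_vars_def by auto
  have "(LINT t:{0..1}|H. f t) = expectation (\<lambda>\<omega>. indicator {0..1} (P 1 \<omega>) *\<^sub>R f (P 1 \<omega>))"
    unfolding set_lebesgue_integral_def ident[of 1, symmetric, simplified]
    by (subst integral_distr) (use rv in auto)
  also have "\<dots> = expectation (\<lambda>\<omega>. f (P 1 \<omega>))"
    by (rule Bochner_Integration.integral_cong) (use range[of 1] in auto)
  finally have E: "(LINT t:{0..1}|H. f t) = expectation (\<lambda>\<omega>. f (P 1 \<omega>))" .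
  have law: "distr M borel (\<lambda>\<omega>. f (P i \<omega>)) = distr H borel f" if "i \<ge> 1" for i
    using distr_distr[OF f rv[OF that]] ident[OF that] by (simp add: comp_def)
  show ?thesis
    unfolding E
  proof (rule slln_bounded[where a = "- B" and b = B])
    show "indep_vars (\<lambda>_. borel) (\<lambda>i \<omega>. f (P i \<omega>)) {1..}"
      by (rule indep_vars_compose2[OF indep]) simp
    show "AE \<omega> in M. f (P 1 \<omega>) \<in> {- B..B}"
      using bound range[of 1] by (intro AE_I2) (force simp: abs_le_iff)
  qed (simp add: law)
qed

section \<open>The rate function and the limit law\<close>

locale proportion_law = prob_space H for H :: "real measure" +
  assumes sets_H [measurable_cong]: "sets H = sets borel"
    and concentrated: "AE t in H. t \<in> {0..1}"
    and nondegenerate: "prob {0, 1} < 1"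
begin

definition mean_cgf :: "real \<Rightarrow> real" where
  "mean_cgf \<theta> = (LINT t:{0..1}|H. bern_cgf \<theta> t)"

lemma tilted_mean_eq: "tilted_mean H \<theta> = (LINT t:{0..1}|H. bern_tilt \<theta> t)"
  by (simp add: tilted_mean_def bern_tilt_def)

lemma set_integrable_bounded:
  fixes f :: "real \<Rightarrow> real"
  assumes "f \<in> borel_measurable borel" "\<And>t. t \<in> {0..1} \<Longrightarrow> \<bar>f t\<bar> \<le> B"
  shows "set_integrable H {0..1} f"
  unfolding set_integrable_def
proof (rule integrable_const_bound)
  show "AE x in H. norm (indicat_real {0..1} x *\<^sub>R f x) \<le> B"
    using concentrated by eventually_elim (use assms(2) in auto)
qed (use assms(1) in measurable)

lemma integrable_tilt: "set_integrable H {0..1} (bern_tilt \<theta>)"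
  by (rule set_integrable_bounded[where B = 1]) (use bern_tilt_range in auto)

lemma integrable_cgf: "set_integrable H {0..1} (bern_cgf \<theta>)"
  by (rule set_integrable_bounded[where B = "\<bar>\<theta>\<bar>"]) (use bern_cgf_bound in auto)

lemma integrable_atom: "set_integrable H {0..1} (\<lambda>t. c * indicator {1} t :: real)"
  by (rule set_integrable_bounded[where B = "\<bar>c\<bar>"]) (auto simp: indicator_def)

lemma integral_atom: "(LINT t:{0..1}|H. c * indicator {1} t :: real) = c * alpha_min H"
proof -
  have "(LINT t:{0..1}|H. c * indicator {1} t) = (LINT t|H. c * indicator {1} t)"
    unfolding set_lebesgue_integral_def
    by (rule Bochner_Integration.integral_cong) (auto simp: indicator_def)
  then show ?thesis by (simp add: alpha_min_def measure_def sets_H)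
qed

lemma set_integral_tendsto:
  fixes f :: "nat \<Rightarrow> real \<Rightarrow> real"
  assumes f: "\<And>n. f n \<in> borel_measurable borel" and g: "g \<in> borel_measurable borel"
    and bound: "\<And>n t. t \<in> {0..1} \<Longrightarrow> \<bar>f n t\<bar> \<le> B"
    and lim: "\<And>t. t \<in> {0..1} \<Longrightarrow> (\<lambda>n. f n t) \<longlonglongrightarrow> g t"
  shows "(\<lambda>n. LINT t:{0..1}|H. f n t) \<longlonglongrightarrow> (LINT t:{0..1}|H. g t)"
  unfolding set_lebesgue_integral_def
proof (rule integral_dominated_convergence[where w = "\<lambda>_. B"])
  show "AE x in H. (\<lambda>n. indicat_real {0..1} x *\<^sub>R f n x) \<longlonglongrightarrow> indicat_real {0..1} x *\<^sub>R g x"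
    using lim by (intro AE_I2) (auto simp: indicator_def)
  show "AE x in H. norm (indicat_real {0..1} x *\<^sub>R f n x) \<le> B" for n
    using concentrated by eventually_elim (use bound in auto)
qed (use f g in measurable)

lemma tilted_mean_0: "tilted_mean H 0 = mean_prop H"
  by (simp add: tilted_mean_eq bern_tilt_0 mean_prop_def)

lemma mean_cgf_0: "mean_cgf 0 = 0"
  by (simp add: mean_cgf_def bern_cgf_0)

lemma tilted_mean_le_1: "tilted_mean H \<theta> \<le> 1"
proof -
  have "tilted_mean H \<theta> \<le> (LINT t:{0..1}|H. 1)"
    unfolding tilted_mean_eq
    by (intro set_integral_mono integrable_tilt set_integrable_bounded[where B = 1])
       (use bern_tilt_range in auto)
  also have "\<dots> \<le> 1" by (simp add: set_lebesgue_integral_def)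
  finally show ?thesis .
qed

lemma tilted_mean_ge: "alpha_min H \<le> tilted_mean H \<theta>"
proof -
  have "(LINT t:{0..1}|H. 1 * indicator {1} t) \<le> tilted_mean H \<theta>"
    unfolding tilted_mean_eq
  proof (intro set_integral_mono integrable_tilt integrable_atom)
    fix t :: real assume "t \<in> {0..1}"
    then show "1 * indicator {1} t \<le> bern_tilt \<theta> t"
      using bern_tilt_range[of t \<theta>] by (auto simp: indicator_def bern_tilt_1)
  qed
  then show ?thesis using integral_atom[of 1] by simp
qed

lemma alpha_min_nonneg: "0 \<le> alpha_min H"
  by (simp add: alpha_min_def)

lemma tilted_mean_nonneg: "0 \<le> tilted_mean H \<theta>"
  using alpha_min_nonneg tilted_mean_ge by (rule order_trans)

lemma mean_cgf_le:
  assumes "\<theta> \<le> 0"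
  shows "mean_cgf \<theta> \<le> \<theta> * alpha_min H"
  unfolding integral_atom[symmetric] mean_cgf_def
  by (intro set_integral_mono integrable_cgf integrable_atom bern_cgf_le assms)

text \<open>
  The slope inequality that replaces differentiation under the integral sign everywhere below.
\<close>

lemma mean_cgf_tangent:
  "tilted_mean H \<theta> * (\<eta> - \<theta>) \<le> mean_cgf \<eta> - mean_cgf \<theta>"
proof -
  have "(LINT t:{0..1}|H. bern_tilt \<theta> t * (\<eta> - \<theta>)) \<le>
        (LINT t:{0..1}|H. bern_cgf \<eta> t - bern_cgf \<theta> t)"
    by (intro set_integral_mono set_integral_diff(1) integrable_cgf bern_cgf_tangent
          set_integrable_mult_left[rotated] integrable_tilt) auto
  then show ?thesis
    by (simp add: tilted_mean_eq mean_cgf_def set_integral_diff(2)[OF integrable_cgf integrable_cgf])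
qed

text \<open>
  The integrand is strictly monotone in \<open>\<theta>\<close> exactly on the open unit interval, which has positive mass
  because \<open>H\<close> is not carried by \<open>{0, 1}\<close>.
\<close>

lemma tilted_mean_strict_mono:
  assumes "\<theta> < \<eta>"
  shows "tilted_mean H \<theta> < tilted_mean H \<eta>"
  unfolding tilted_mean_eq set_lebesgue_integral_def
proof (rule integral_less_AE)
  show "integrable H (\<lambda>t. indicat_real {0..1} t *\<^sub>R bern_tilt \<theta> t)"
       "integrable H (\<lambda>t. indicat_real {0..1} t *\<^sub>R bern_tilt \<eta> t)"
    using integrable_tilt unfolding set_integrable_def by auto
  show "{0<..<1::real} \<in> sets H" by (simp add: sets_H)
  have "prob ({0, 1} \<union> {0<..<1}) = 1"
  proof (subst prob_eq_1)
    show "AE t in H. t \<in> {0, 1} \<union> {0<..<1}"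
      using concentrated by eventually_elim auto
  qed (auto simp: sets_H)
  moreover have "prob ({0, 1} \<union> {0<..<1}) \<le> prob {0, 1} + prob {0<..<1}"
    by (intro measure_Un_le) (auto simp: sets_H)
  ultimately show "emeasure H {0<..<1} \<noteq> 0"
    using nondegenerate by (auto simp: emeasure_eq_measure)
  show "AE t in H. t \<in> {0<..<1} \<longrightarrow>
      indicat_real {0..1} t *\<^sub>R bern_tilt \<theta> t \<noteq> indicat_real {0..1} t *\<^sub>R bern_tilt \<eta> t"
    using bern_tilt_strict_mono[OF _ assms] by (intro AE_I2) (fastforce simp: indicator_def)
  show "AE t in H. indicat_real {0..1} t *\<^sub>R bern_tilt \<theta> t \<le> indicat_real {0..1} t *\<^sub>R bern_tilt \<eta> t"
    using bern_tilt_mono assms by (intro AE_I2) (auto simp: indicator_def)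
qed

lemma tilted_mean_mono: "\<theta> \<le> \<eta> \<Longrightarrow> tilted_mean H \<theta> \<le> tilted_mean H \<eta>"
  using tilted_mean_strict_mono[of \<theta> \<eta>] by (cases "\<theta> = \<eta>") auto

lemma tilted_mean_less_iff: "tilted_mean H \<theta> < tilted_mean H \<eta> \<longleftrightarrow> \<theta> < \<eta>"
  using tilted_mean_strict_mono tilted_mean_mono by (meson not_less)

lemma alpha_min_less: "alpha_min H < tilted_mean H \<theta>"
  using tilted_mean_ge[of "\<theta> - 1"] tilted_mean_strict_mono[of "\<theta> - 1" \<theta>] by simp

lemma isCont_tilted_mean: "isCont (tilted_mean H) \<theta>"
  unfolding continuous_at_sequentially
proof (intro allI impI)
  fix u assume u: "u \<longlonglongrightarrow> \<theta>"
  show "(tilted_mean H \<circ> u) \<longlonglongrightarrow> tilted_mean H \<theta>"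
    unfolding tilted_mean_eq comp_def
  proof (rule set_integral_tendsto[where B = 1])
    fix t :: real assume t: "t \<in> {0..1}"
    show "(\<lambda>n. bern_tilt (u n) t) \<longlonglongrightarrow> bern_tilt \<theta> t"
      unfolding bern_tilt_def using bern_mgf_pos[OF t, of \<theta>]
      by (intro tendsto_intros u) auto
  qed (use bern_tilt_range in auto)
qed

lemma isCont_mean_cgf: "isCont mean_cgf \<theta>"
  unfolding isCont_def
proof (rule LIM_I)
  fix r :: real assume "r > 0"
  \<comment> \<open>the tangents at both end points have slopes in \<open>[0, 1]\<close>\<close>
  have "\<bar>mean_cgf \<eta> - mean_cgf \<theta>\<bar> \<le> \<bar>\<eta> - \<theta>\<bar>" for \<eta>
  proof -
    have m: "\<bar>tilted_mean H \<zeta>\<bar> \<le> 1" for \<zeta>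
      using tilted_mean_le_1[of \<zeta>] tilted_mean_nonneg[of \<zeta>] by simp
    have "\<bar>tilted_mean H \<zeta> * (\<eta> - \<theta>)\<bar> \<le> 1 * \<bar>\<eta> - \<theta>\<bar>" for \<zeta>
      unfolding abs_mult using m by (intro mult_right_mono) auto
    from this[of \<theta>] this[of \<eta>] show ?thesis
      using mean_cgf_tangent[of \<theta> \<eta>] mean_cgf_tangent[of \<eta> \<theta>] by (simp add: algebra_simps)
  qed
  then show "\<exists>s>0. \<forall>x. x \<noteq> \<theta> \<and> norm (x - \<theta>) < s \<longrightarrow> norm (mean_cgf x - mean_cgf \<theta>) < r"
    using \<open>r > 0\<close> by (intro exI[of _ r]) (auto intro: le_less_trans)
qed

text \<open>
  As \<open>\<theta> \<rightarrow> -\<infinity>\<close> tilting sends every success probability below 1 to 0, so only the atom of \<open>H\<close> at 1 survives.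
\<close>

lemma tilted_mean_near_alpha_min:
  assumes "\<epsilon> > 0"
  obtains \<theta> where "\<theta> < 0" "tilted_mean H \<theta> < alpha_min H + \<epsilon>"
proof -
  have "(\<lambda>n. tilted_mean H (- real n)) \<longlonglongrightarrow> (LINT t:{0..1}|H. 1 * indicator {1} t)"
    unfolding tilted_mean_eq
  proof (rule set_integral_tendsto[where B = 1])
    fix t :: real assume t: "t \<in> {0..1}"
    have e: "(\<lambda>n. exp (- real n)) \<longlonglongrightarrow> 0"
      by real_asymp
    show "(\<lambda>n. bern_tilt (- real n) t) \<longlonglongrightarrow> 1 * indicator {1} t"
    proof (cases "t = 1")
      case False
      have "(\<lambda>n. t * exp (- real n) / (1 - t + t * exp (- real n))) \<longlonglongrightarrow> t * 0 / (1 - t + t * 0)"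
        by (intro tendsto_intros e) (use False in auto)
      then show ?thesis using False by (simp add: bern_tilt_def)
    qed (simp add: bern_tilt_1)
  qed (use bern_tilt_range in auto)
  then have "(\<lambda>n. tilted_mean H (- real n)) \<longlonglongrightarrow> alpha_min H"
    using integral_atom[of 1] by simp
  then have "eventually (\<lambda>n. tilted_mean H (- real n) < alpha_min H + \<epsilon> \<and> n > 0) sequentially"
    using assms by (intro eventually_conj order_tendstoD(2)[of _ "alpha_min H"] eventually_gt_at_top) auto
  then obtain n where "tilted_mean H (- real n) < alpha_min H + \<epsilon>" "n > 0"
    by (auto dest: eventually_happens)
  then show ?thesis by (intro that[of "- real n"]) auto
qed

text \<open>
  The Legendre transform of \<open>mean_cgf\<close> at the point \<open>tilted_mean H \<theta>\<close>: the rate function, parametrised by the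
  tilt instead of by its argument, which avoids inverting \<open>tilted_mean H\<close>.
\<close>

definition legendre :: "real \<Rightarrow> real" where
  "legendre \<theta> = \<theta> * tilted_mean H \<theta> - mean_cgf \<theta>"

lemma tilted_mean_inverse:
  assumes "alpha_min H < a" "a < mean_prop H"
  obtains \<theta> where "\<theta> < 0" "tilted_mean H \<theta> = a"
proof -
  obtain \<eta> where \<eta>: "\<eta> < 0" "tilted_mean H \<eta> < a"
    using tilted_mean_near_alpha_min[of "a - alpha_min H"] assms by auto
  have "\<exists>\<theta>\<ge>\<eta>. \<theta> \<le> 0 \<and> tilted_mean H \<theta> = a"
    by (rule IVT) (use \<eta> assms isCont_tilted_mean in \<open>auto simp: tilted_mean_0\<close>)
  then obtain \<theta> where "\<theta> \<le> 0" "tilted_mean H \<theta> = a" by blast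
  moreover have "\<theta> \<noteq> 0" using calculation(2) assms tilted_mean_0 by auto
  ultimately show ?thesis using that by (metis less_eq_real_def)
qed

lemma tilt_tilted_mean: "tilt H (tilted_mean H \<theta>) = \<theta>"
  unfolding tilt_def
  by (rule the_equality) (auto intro: order_antisym simp flip: not_less tilted_mean_less_iff)

lemma rate_int_tilted_mean: "rate_int H (tilted_mean H \<theta>) = legendre \<theta>"
  by (simp add: rate_int_def tilt_tilted_mean legendre_def mean_cgf_def bern_cgf_def mult.commute)

text \<open>
  Formally \<open>legendre\<close> has derivative \<open>\<theta>\<close> times that of \<open>tilted_mean\<close>. This is the corresponding difference
  inequality; it comes from the tangent at \<open>\<theta>\<close>.
\<close>

lemma legendre_mono_step:
  assumes "\<eta> \<le> 0" "\<theta> < \<eta>"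
  shows "\<eta> * (tilted_mean H \<theta> - tilted_mean H \<eta>) \<le> legendre \<theta> - legendre \<eta>"
  using mean_cgf_tangent[of \<theta> \<eta>] by (simp add: legendre_def algebra_simps)

lemma legendre_strict_antimono:
  assumes "\<theta> < \<eta>" "\<eta> < 0"
  shows "legendre \<eta> < legendre \<theta>"
proof -
  have "0 < \<eta> * (tilted_mean H \<theta> - tilted_mean H \<eta>)"
    using assms tilted_mean_strict_mono by (intro mult_neg_neg) auto
  then show ?thesis using legendre_mono_step[of \<eta> \<theta>] assms by auto
qed

lemma legendre_less_iff:
  assumes "\<theta> < 0" "\<eta> < 0"
  shows "legendre \<eta> < legendre \<theta> \<longleftrightarrow> \<theta> < \<eta>"
  using legendre_strict_antimono assms by (metis linorder_less_linear order_less_asym)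

lemma legendre_0: "legendre 0 = 0"
  by (simp add: legendre_def mean_cgf_0)

lemma legendre_pos:
  assumes "\<theta> < 0"
  shows "legendre \<theta> > 0"
  \<comment> \<open>the step down to 0 is only weakly monotone, so strictness is gained on the way to \<open>\<theta> / 2\<close>\<close>
  using legendre_strict_antimono[of \<theta> "\<theta> / 2"] legendre_mono_step[of 0 "\<theta> / 2"] assms
  by (simp add: legendre_0)

lemma isCont_legendre: "isCont legendre \<theta>"
  unfolding legendre_def by (intro continuous_intros isCont_tilted_mean isCont_mean_cgf)

definition rate_sup :: ereal where
  "rate_sup = (SUP \<theta>\<in>{..<0}. ereal (legendre \<theta>))"

lemma legendre_less_rate_sup:
  assumes "\<theta> < 0"
  shows "ereal (legendre \<theta>) < rate_sup"
proof -
  have "ereal (legendre \<theta>) < ereal (legendre (\<theta> - 1))"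
    using legendre_strict_antimono[of "\<theta> - 1" \<theta>] assms by simp
  also have "\<dots> \<le> rate_sup"
    unfolding rate_sup_def using assms by (intro SUP_upper) auto
  finally show ?thesis .
qed

text \<open>
  For \<open>a = tilted_mean H \<theta>\<close> the limit \<open>a \<rightarrow> alpha_min H\<close> is the limit \<open>\<theta> \<rightarrow> -\<infinity>\<close>, along which \<open>legendre\<close>
  increases; so the limit exists, possibly infinite, and is the supremum.
\<close>

lemma rate_alpha_min: "rate H (alpha_min H) = rate_sup"
proof -
  have "((\<lambda>a. ereal (rate_int H a)) \<longlongrightarrow> rate_sup) (at_right (alpha_min H))"
  proof (rule order_tendstoI)
    fix y assume "y < rate_sup"
    then obtain \<theta> where \<theta>: "\<theta> < 0" "y < ereal (legendre \<theta>)"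
      unfolding rate_sup_def less_SUP_iff by auto
    have "y < ereal (rate_int H a)" if a: "alpha_min H < a" "a < tilted_mean H \<theta>" for a
    proof -
      have "a < mean_prop H"
        using that tilted_mean_mono[of \<theta> 0] \<theta> by (simp add: tilted_mean_0)
      then obtain \<eta> where \<eta>: "\<eta> < 0" "tilted_mean H \<eta> = a"
        using tilted_mean_inverse a(1) by blast
      then have "\<eta> < \<theta>" using that tilted_mean_less_iff by blast
      then have "legendre \<theta> < legendre \<eta>" using legendre_strict_antimono \<theta> by simp
      then show ?thesis
        using \<theta>(2) rate_int_tilted_mean[of \<eta>] \<eta>(2) by (metis less_ereal.simps(1) order_less_trans)
    qed
    then show "\<forall>\<^sub>F a in at_right (alpha_min H). y < ereal (rate_int H a)"
      using alpha_min_less[of \<theta>] unfolding eventually_at_right_field by blast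
  next
    fix y assume y: "rate_sup < y"
    have "ereal (rate_int H a) < y" if a: "alpha_min H < a" "a < tilted_mean H 0" for a
    proof -
      obtain \<eta> where "\<eta> < 0" "tilted_mean H \<eta> = a"
        using tilted_mean_inverse a by (metis tilted_mean_0)
      then show ?thesis
        using legendre_less_rate_sup[of \<eta>] y rate_int_tilted_mean[of \<eta>] by auto
    qed
    then show "\<forall>\<^sub>F a in at_right (alpha_min H). ereal (rate_int H a) < y"
      using alpha_min_less[of 0] unfolding eventually_at_right_field by blast
  qed
  then have "Lim (at_right (alpha_min H)) (\<lambda>a. ereal (rate_int H a)) = rate_sup"
    by (intro tendsto_Lim) auto
  moreover have "alpha_min H \<noteq> mean_prop H"
    using alpha_min_less[of 0] by (simp add: tilted_mean_0)
  ultimately show ?thesis by (simp add: rate_def)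
qed

text \<open>
  What \<open>x_star\<close> means for the parametrisation: for \<open>x\<close> up to it, \<open>exp (- legendre \<theta>)\<close> exceeds \<open>x\<close> for every
  tilt; above it some tilt hits \<open>x\<close> exactly and computes \<open>alpha_I\<close> (\<open>above_x_star\<close>).
\<close>

lemma below_x_star:
  assumes "x \<le> x_star H" "\<theta> < 0"
  shows "x < exp (- legendre \<theta>)"
proof (cases "rate_sup = \<infinity>")
  case True
  then show ?thesis using assms by (simp add: x_star_def rate_alpha_min le_less_trans)
next
  case False
  then obtain l where l: "rate_sup = ereal l"
    using legendre_less_rate_sup[OF assms(2)] by (cases rate_sup) auto
  then have "x_star H = exp (- l)" by (simp add: x_star_def rate_alpha_min)
  moreover have "legendre \<theta> < l" using legendre_less_rate_sup[OF assms(2)] l by simp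
  ultimately show ?thesis using assms(1) by (simp add: le_less_trans)
qed

lemma x_star_nonneg: "0 \<le> x_star H"
  by (simp add: x_star_def)

lemma above_x_star:
  assumes "x_star H < x" "x < 1"
  obtains \<theta> where "\<theta> < 0" "legendre \<theta> = - ln x" "alpha_I H x = tilted_mean H \<theta>"
proof -
  have x: "x > 0" using assms x_star_nonneg by linarith
  have "ereal (- ln x) < rate_sup"
  proof (cases "rate_sup = \<infinity>")
    case False
    then obtain l where l: "rate_sup = ereal l"
      using legendre_less_rate_sup[of "-1"] by (cases rate_sup) auto
    then have "exp (- l) < x" using assms by (simp add: x_star_def rate_alpha_min)
    then have "- l < ln x" using x by (metis exp_less_cancel_iff exp_ln)
    then show ?thesis by (simp add: l)
  qed simp
  then obtain \<eta> where \<eta>: "\<eta> < 0" "- ln x < legendre \<eta>"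
    unfolding rate_sup_def less_SUP_iff by auto
  have "\<exists>\<theta>\<ge>\<eta>. \<theta> \<le> 0 \<and> legendre \<theta> = - ln x"
    by (rule IVT2) (use \<eta> x assms isCont_legendre in \<open>auto simp: legendre_0\<close>)
  then obtain \<theta> where "\<theta> \<le> 0" and eq: "legendre \<theta> = - ln x" by blast
  moreover have "\<theta> \<noteq> 0" using eq x assms by (auto simp: legendre_0)
  ultimately have \<theta>: "\<theta> < 0" by simp
  have target: "log_recip x = ereal (- ln x)"
    using x by (simp add: log_recip_def ln_div)
  have rate_inner: "rate H (tilted_mean H \<zeta>) = ereal (legendre \<zeta>)" if "\<zeta> < 0" for \<zeta>
    using that alpha_min_less[of \<zeta>] tilted_mean_strict_mono[of \<zeta> 0]
    by (simp add: rate_def rate_int_tilted_mean tilted_mean_0)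
  have "alpha_I H x = tilted_mean H \<theta>"
    unfolding alpha_I_def
  proof (rule the_equality)
    show "tilted_mean H \<theta> \<in> {alpha_min H..mean_prop H} \<and> rate H (tilted_mean H \<theta>) = log_recip x"
      using tilted_mean_ge[of \<theta>] tilted_mean_mono[of \<theta> 0] \<theta>
      by (simp add: tilted_mean_0 rate_inner target eq)
  next
    fix a assume a: "a \<in> {alpha_min H..mean_prop H} \<and> rate H a = log_recip x"
    have "a \<noteq> mean_prop H"
      using a x assms by (auto simp: rate_def target zero_ereal_def)
    moreover have "a \<noteq> alpha_min H"
      using a \<open>ereal (- ln x) < rate_sup\<close> rate_alpha_min target by auto
    ultimately obtain \<zeta> where \<zeta>: "\<zeta> < 0" "tilted_mean H \<zeta> = a"
      using a tilted_mean_inverse[of a] by auto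
    then have "legendre \<zeta> = legendre \<theta>" using a rate_inner[of \<zeta>] target eq by simp
    then have "\<zeta> = \<theta>" using legendre_less_iff \<zeta> \<theta> by (metis linorder_less_linear order_less_irrefl)
    then show "a = tilted_mean H \<theta>" using \<zeta> by simp
  qed
  then show ?thesis using that \<theta> eq by blast
qed

text \<open>
  Together with \<open>tilted_mean_near_g_cdf\<close> below: on \<open>[0, 1)\<close>, \<open>g_cdf H x\<close> is the infimum of
  \<open>tilted_mean H \<theta>\<close> over the \<open>\<theta> < 0\<close> with \<open>x < exp (- legendre \<theta>)\<close>. This covers both sides of
  \<open>x_star\<close> at once. The condition on \<open>x\<close> is strict, hence stable under small changes of \<open>x\<close> and of \<open>\<theta>\<close>:
  the former gives right continuity of \<open>g_cdf\<close>, the latter allows rational \<open>\<theta>\<close>.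
\<close>

lemma g_cdf_le_tilted_mean:
  assumes "0 \<le> x" "x < 1" "\<theta> < 0" "x < exp (- legendre \<theta>)"
  shows "g_cdf H x \<le> tilted_mean H \<theta>"
proof (cases "x \<le> x_star H")
  case True
  then show ?thesis using assms tilted_mean_ge by (simp add: g_cdf_def)
next
  case False
  then obtain \<zeta> where \<zeta>: "\<zeta> < 0" "legendre \<zeta> = - ln x" "alpha_I H x = tilted_mean H \<zeta>"
    using above_x_star[of x] assms by auto
  have "x > 0" using False x_star_nonneg by linarith
  then have "ln x < - legendre \<theta>" using assms by (metis exp_less_cancel_iff exp_ln)
  then have "legendre \<theta> < legendre \<zeta>" using \<zeta> by simp
  then have "\<zeta> < \<theta>" using legendre_less_iff \<zeta> assms by blast
  then show ?thesis using False assms \<zeta> tilted_mean_mono[of \<zeta> \<theta>] by (simp add: g_cdf_def)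
qed

lemma rational_near_right:
  fixes a :: real
  assumes "eventually P (at_right a)" "a < 0"
  obtains \<theta> where "\<theta> \<in> \<rat>" "a < \<theta>" "\<theta> < 0" "P \<theta>"
proof -
  obtain b where b: "b > a" "\<And>y. a < y \<Longrightarrow> y < b \<Longrightarrow> P y"
    using assms(1) unfolding eventually_at_right_field by blast
  obtain r where "r \<in> \<rat>" "a < r" "r < min b 0"
    using Rats_dense_in_real[of a "min b 0"] b assms by auto
  then show ?thesis using b that by auto
qed

lemma tilted_mean_near_g_cdf:
  assumes "0 \<le> x" "x < 1" "\<epsilon> > 0"
  obtains \<theta> where "\<theta> \<in> \<rat>" "\<theta> < 0" "x < exp (- legendre \<theta>)" "tilted_mean H \<theta> < g_cdf H x + \<epsilon>"
proof (cases "x \<le> x_star H")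
  case True
  obtain \<eta> where \<eta>: "\<eta> < 0" "tilted_mean H \<eta> < alpha_min H + \<epsilon>"
    using tilted_mean_near_alpha_min \<open>\<epsilon> > 0\<close> by blast
  obtain \<theta> where \<theta>: "\<theta> \<in> \<rat>" "\<theta> < \<eta>"
    using Rats_dense_in_real[of "\<eta> - 1" \<eta>] by auto
  show ?thesis
    using that[of \<theta>] \<theta> \<eta> True below_x_star[of x \<theta>] tilted_mean_mono[of \<theta> \<eta>] assms
    by (simp add: g_cdf_def)
next
  case False
  then obtain \<zeta> where \<zeta>: "\<zeta> < 0" "legendre \<zeta> = - ln x" "alpha_I H x = tilted_mean H \<zeta>"
    using above_x_star[of x] assms by auto
  have x: "x > 0" using False x_star_nonneg by linarith
  have g: "g_cdf H x = tilted_mean H \<zeta>" using False assms \<zeta> by (simp add: g_cdf_def)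
  have "(tilted_mean H \<longlongrightarrow> tilted_mean H \<zeta>) (at_right \<zeta>)"
    using isCont_tilted_mean[of \<zeta>] unfolding isCont_def by (rule filterlim_at_split[THEN iffD1, THEN conjunct2])
  then have "eventually (\<lambda>\<theta>. tilted_mean H \<theta> < tilted_mean H \<zeta> + \<epsilon>) (at_right \<zeta>)"
    using \<open>\<epsilon> > 0\<close> by (intro order_tendstoD(2)) auto
  then obtain \<theta> where \<theta>: "\<theta> \<in> \<rat>" "\<zeta> < \<theta>" "\<theta> < 0" "tilted_mean H \<theta> < tilted_mean H \<zeta> + \<epsilon>"
    using rational_near_right \<zeta>(1) by blast
  have "ln x < - legendre \<theta>" using legendre_strict_antimono[of \<zeta> \<theta>] \<theta> \<zeta> by simp
  then have "x < exp (- legendre \<theta>)" using x by (metis exp_less_cancel_iff exp_ln)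
  then show ?thesis using that[of \<theta>] \<theta> g by simp
qed

text \<open>
  The exponent in the Markov bound at \<open>k / n = g_cdf H x - \<epsilon>\<close> can be pushed below \<open>ln x\<close>. Above \<open>x_star\<close> the
  optimal tilt \<open>\<zeta>\<close> has exponent \<open>ln x\<close> at \<open>k / n = g_cdf H x\<close>, and decreasing \<open>k / n\<close> gains \<open>\<epsilon> \<zeta>\<close>.
  At or below \<open>x_star\<close> the gain is \<open>\<epsilon> \<theta>\<close> for arbitrarily negative \<open>\<theta>\<close>.
\<close>

lemma chernoff_exponent_below:
  assumes "0 < x" "x < 1" "\<epsilon> > 0"
  obtains \<theta> where "\<theta> \<in> \<rat>" "\<theta> < 0" "mean_cgf \<theta> - \<theta> * (g_cdf H x - \<epsilon>) < ln x"
proof (cases "x \<le> x_star H")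
  case True
  obtain \<theta> where \<theta>: "\<theta> \<in> \<rat>" "\<theta> < ln x / \<epsilon>"
    using Rats_dense_in_real[of "ln x / \<epsilon> - 1" "ln x / \<epsilon>"] by auto
  have neg: "\<theta> < 0"
    using \<theta>(2) assms by (smt (verit) divide_neg_pos ln_less_zero)
  have g: "g_cdf H x = alpha_min H" using True assms by (simp add: g_cdf_def)
  have "mean_cgf \<theta> - \<theta> * (g_cdf H x - \<epsilon>) \<le> \<theta> * \<epsilon>"
    using mean_cgf_le[of \<theta>] neg by (simp add: g algebra_simps)
  also have "\<dots> < ln x" using \<theta>(2) assms by (simp add: field_simps)
  finally show ?thesis using that \<theta> neg by blast
next
  case False
  then obtain \<zeta> where \<zeta>: "\<zeta> < 0" "legendre \<zeta> = - ln x" "alpha_I H x = tilted_mean H \<zeta>"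
    using above_x_star[of x] assms by auto
  have g: "g_cdf H x = tilted_mean H \<zeta>" using False assms \<zeta> by (simp add: g_cdf_def)
  define f where "f = (\<lambda>\<theta>. mean_cgf \<theta> - \<theta> * (g_cdf H x - \<epsilon>))"
  have "isCont f \<zeta>"
    unfolding f_def by (intro continuous_intros isCont_mean_cgf)
  then have "(f \<longlongrightarrow> f \<zeta>) (at_right \<zeta>)"
    unfolding isCont_def by (rule filterlim_at_split[THEN iffD1, THEN conjunct2])
  moreover have "f \<zeta> < ln x"
    using \<zeta> mult_neg_pos[OF \<zeta>(1) \<open>\<epsilon> > 0\<close>] by (simp add: f_def g legendre_def algebra_simps)
  ultimately have "eventually (\<lambda>\<theta>. f \<theta> < ln x) (at_right \<zeta>)"
    by (rule order_tendstoD(2))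
  then obtain \<theta> where "\<theta> \<in> \<rat>" "\<zeta> < \<theta>" "\<theta> < 0" "f \<theta> < ln x"
    using rational_near_right \<zeta>(1) by blast
  then show ?thesis using that by (simp add: f_def)
qed

lemma g_cdf_ge_1:
  assumes "x \<ge> 1"
  shows "g_cdf H x = 1"
proof -
  have "x_star H < 1"
    using below_x_star[of "x_star H" "-1"] legendre_pos[of "-1"] by (simp add: order_less_trans)
  then show ?thesis using assms by (simp add: g_cdf_def)
qed

lemma g_cdf_mono:
  assumes "x \<le> y"
  shows "g_cdf H x \<le> g_cdf H y"
proof -
  consider "x < 0" "y < 0" | "x < 0" "0 \<le> y" "y < 1" | "0 \<le> x" "y < 1" | "x < 0" "1 \<le> y"
    | "0 \<le> x" "x < 1" "1 \<le> y" | "1 \<le> x"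
    using assms by linarith
  then show ?thesis
  proof cases
    case 2
    have "0 \<le> g_cdf H y"
    proof (cases "y \<le> x_star H")
      case True
      then show ?thesis using 2 by (simp add: g_cdf_def alpha_min_nonneg)
    next
      case False
      then obtain \<theta> where "alpha_I H y = tilted_mean H \<theta>" using above_x_star[of y] 2 by auto
      then show ?thesis
        using 2 False tilted_mean_nonneg[of \<theta>] by (simp add: g_cdf_def)
    qed
    then show ?thesis using 2 by (simp add: g_cdf_def)
  next
    case 3
    show ?thesis
    proof (rule field_le_epsilon)
      fix e :: real assume "e > 0"
      obtain \<theta> where "\<theta> < 0" "y < exp (- legendre \<theta>)" "tilted_mean H \<theta> < g_cdf H y + e"
        using tilted_mean_near_g_cdf[of y e] 3 assms \<open>e > 0\<close> by auto
      then show "g_cdf H x \<le> g_cdf H y + e"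
        using g_cdf_le_tilted_mean[of x \<theta>] 3 assms by simp
    qed
  next
    case 5
    obtain \<theta> where "\<theta> < 0" "x < exp (- legendre \<theta>)"
      using tilted_mean_near_g_cdf[of x 1] 5 by auto
    then show ?thesis
      using g_cdf_le_tilted_mean[of x \<theta>] tilted_mean_le_1[of \<theta>] 5 by (simp add: g_cdf_ge_1)
  next
    case 4
    then show ?thesis by (simp add: g_cdf_ge_1) (simp add: g_cdf_def)
  qed (use assms in \<open>simp_all add: g_cdf_ge_1\<close>, simp add: g_cdf_def)
qed

lemma g_cdf_range: "g_cdf H x \<in> {0..1}"
proof -
  have "g_cdf H (min x (- 1)) = 0" by (simp add: g_cdf_def)
  moreover have "g_cdf H (max x 1) = 1" by (rule g_cdf_ge_1) simp
  ultimately show ?thesis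
    using g_cdf_mono[of "min x (- 1)" x] g_cdf_mono[of x "max x 1"] by simp
qed

lemma g_cdf_right_continuous: "continuous (at_right a) (g_cdf H)"
  unfolding continuous_within
proof -
  consider "a < 0" | "0 \<le> a" "a < 1" | "1 \<le> a" by linarith
  then show "(g_cdf H \<longlongrightarrow> g_cdf H a) (at_right a)"
  proof cases
    case 1
    have "eventually (\<lambda>x. g_cdf H x = g_cdf H a) (at_right a)"
      unfolding eventually_at_right_field using 1 by (intro exI[of _ 0]) (simp add: g_cdf_def)
    then show ?thesis by (rule tendsto_eventually)
  next
    case 3
    have "eventually (\<lambda>x. g_cdf H x = g_cdf H a) (at_right a)"
      unfolding eventually_at_right_field using 3
      by (intro exI[of _ "a + 1"]) (simp add: g_cdf_ge_1)
    then show ?thesis by (rule tendsto_eventually)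
  next
    case 2
    show ?thesis
    proof (rule order_tendstoI)
      fix y assume "y < g_cdf H a"
      then have "y < g_cdf H x" if "a < x" for x
        using g_cdf_mono[of a x] that by simp
      then show "\<forall>\<^sub>F x in at_right a. y < g_cdf H x"
        unfolding eventually_at_right_field by (intro exI[of _ "a + 1"]) simp
    next
      fix y assume y: "g_cdf H a < y"
      obtain \<theta> where \<theta>: "\<theta> < 0" "a < exp (- legendre \<theta>)"
          "tilted_mean H \<theta> < g_cdf H a + (y - g_cdf H a)"
        using tilted_mean_near_g_cdf[of a "y - g_cdf H a"] 2 y by auto
      have "g_cdf H x < y" if "a < x" "x < min 1 (exp (- legendre \<theta>))" for x
        using g_cdf_le_tilted_mean[of x \<theta>] that 2 \<theta> by simp
      then show "\<forall>\<^sub>F x in at_right a. g_cdf H x < y"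
        unfolding eventually_at_right_field using 2 \<theta>
        by (intro exI[of _ "min 1 (exp (- legendre \<theta>))"]) simp
    qed
  qed
qed

lemma g_cdf_at_bot: "(g_cdf H \<longlongrightarrow> 0) at_bot"
  by (rule tendsto_eventually)
     (use eventually_gt_at_bot[of 0] in \<open>eventually_elim; simp add: g_cdf_def\<close>)

lemma g_cdf_at_top: "(g_cdf H \<longlongrightarrow> 1) at_top"
  by (rule tendsto_eventually)
     (use eventually_ge_at_top[of 1] in \<open>eventually_elim; simp add: g_cdf_ge_1\<close>)

lemma real_distribution_g_tilde: "real_distribution (g_tilde H)"
  unfolding g_tilde_def
  by (intro real_distribution_interval_measure g_cdf_mono g_cdf_right_continuous
        g_cdf_at_bot g_cdf_at_top)

lemma cdf_g_tilde: "cdf (g_tilde H) = g_cdf H"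
  unfolding g_tilde_def
  by (intro cdf_interval_measure g_cdf_mono g_cdf_right_continuous g_cdf_at_bot)

lemma g_tilde_unit_interval: "measure (g_tilde H) {0..1} = 1"
proof -
  interpret G: real_distribution "g_tilde H" by (rule real_distribution_g_tilde)
  have "(cdf (g_tilde H) \<longlongrightarrow> 0) (at_left 0)"
    unfolding cdf_g_tilde
    by (rule tendsto_eventually) (auto simp: eventually_at_left_field g_cdf_def intro: exI[of _ "-1"])
  then have "measure (g_tilde H) {..<0} = 0"
    using tendsto_unique[OF _ G.cdf_at_left[of 0]] by simp
  moreover have "measure (g_tilde H) {..1} = 1"
    using cdf_g_tilde by (simp add: cdf_def fun_eq_iff g_cdf_ge_1)
  moreover have "measure (g_tilde H) {..1} = measure (g_tilde H) ({..<0} \<union> {0..1})"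
    by (rule arg_cong[of _ _ "measure (g_tilde H)"]) auto
  moreover have "\<dots> \<le> measure (g_tilde H) {..<0} + measure (g_tilde H) {0..1}"
    by (intro measure_Un_le) auto
  ultimately show ?thesis using G.prob_le_1[of "{0..1}"] by linarith
qed

end

section \<open>Convergence for typical proportions\<close>

lemma cdf_emp_transformed:
  assumes "n \<ge> 1"
  shows "cdf (emp_transformed P n) x = real (card {k \<in> {1..n}. root n (break_pt P n k) \<le> x}) / real n"
proof -
  have "cdf (emp_transformed P n) x =
          measure (uniform_count_measure {1..n}) ((\<lambda>k. root n (break_pt P n k)) -` {..x} \<inter> {1..n})"
    unfolding cdf_def emp_transformed_def
    by (subst measure_distr)
       (auto simp: space_uniform_count_measure measurable_def sets_uniform_count_measure)
  also have "\<dots> = real (card ((\<lambda>k. root n (break_pt P n k)) -` {..x} \<inter> {1..n})) / real n"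
    using assms by (subst measure_uniform_count_measure) auto
  also have "(\<lambda>k. root n (break_pt P n k)) -` {..x} \<inter> {1..n} = {k \<in> {1..n}. root n (break_pt P n k) \<le> x}"
    by auto
  finally show ?thesis .
qed

lemma root_exp_mult: "n \<ge> 1 \<Longrightarrow> root n (exp (real n * c)) = exp c"
  by (simp add: exp_of_nat_mult real_root_power_cancel)

lemma const_over_nat_tendsto_0: "(\<lambda>n. c / real n) \<longlonglongrightarrow> 0"
  by real_asymp

text \<open>
  The properties of a realisation of the proportions on which the convergence depends. Rational tilts are
  enough and make this an almost sure event, as a countable intersection.
\<close>

locale typical_proportions = proportion_law +
  fixes p :: "nat \<Rightarrow> real"
  assumes range: "\<And>i. i \<ge> 1 \<Longrightarrow> p i \<in> {0..1}"
    and cgf_average: "\<And>\<theta>. \<theta> \<in> \<rat> \<Longrightarrow>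
          (\<lambda>n. (\<Sum>i=1..n. bern_cgf \<theta> (p i)) / real n) \<longlonglongrightarrow> mean_cgf \<theta>"
    and tilt_average: "\<And>\<theta>. \<theta> \<in> \<rat> \<Longrightarrow>
          (\<lambda>n. (\<Sum>i=1..n. bern_tilt \<theta> (p i)) / real n) \<longlonglongrightarrow> tilted_mean H \<theta>"
begin

abbreviation "A \<equiv> break_pt (\<lambda>n k. p n)"
abbreviation "G n x \<equiv> cdf (emp_transformed (\<lambda>n k. p n) n) x"

text \<open>
  For large \<open>n\<close>, all \<open>k\<close> from \<open>(g_cdf H x + \<epsilon>) n\<close> on have transformed break point above \<open>x\<close>:
  choose a tilt with mean below \<open>g_cdf H x + \<epsilon>\<close> whose rate is still below \<open>ln (1 / x)\<close> and apply the change-of-measure bound.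
\<close>

lemma empirical_cdf_upper:
  assumes "0 \<le> x" "x < 1" "\<epsilon> > 0"
  shows "eventually (\<lambda>n. G n x \<le> g_cdf H x + \<epsilon>) sequentially"
proof -
  define g where "g = g_cdf H x"
  obtain \<theta> where \<theta>: "\<theta> \<in> \<rat>" "\<theta> < 0" "x < exp (- legendre \<theta>)" "tilted_mean H \<theta> < g + \<epsilon>"
    using tilted_mean_near_g_cdf[OF assms] unfolding g_def by blast
  define C where "C = (\<lambda>n. (\<Sum>i=1..n. bern_cgf \<theta> (p i)) / real n)"
  define T where "T = (\<lambda>n. (\<Sum>i=1..n. bern_tilt \<theta> (p i)) / real n)"
  have "((\<lambda>\<delta>. exp (- legendre \<theta> + \<theta> * \<delta>)) \<longlongrightarrow> exp (- legendre \<theta> + \<theta> * 0)) (at_right 0)"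
    by (intro tendsto_intros)
  then have "\<forall>\<^sub>F \<delta> in at_right 0. x < exp (- legendre \<theta> + \<theta> * \<delta>)"
    using \<theta> by (intro order_tendstoD(1)) auto
  moreover have "((\<lambda>\<delta>. tilted_mean H \<theta> + \<delta>) \<longlongrightarrow> tilted_mean H \<theta> + 0) (at_right 0)"
    by (intro tendsto_intros)
  then have "\<forall>\<^sub>F \<delta> in at_right 0. tilted_mean H \<theta> + \<delta> < g + \<epsilon>"
    using \<theta> by (intro order_tendstoD(2)) auto
  ultimately have "\<forall>\<^sub>F \<delta> in at_right 0. \<delta> > 0 \<and> x < exp (- legendre \<theta> + \<theta> * \<delta>)
      \<and> tilted_mean H \<theta> + \<delta> < g + \<epsilon>"
    using eventually_at_right_less by (intro eventually_conj) auto
  then obtain \<delta> where \<delta>: "\<delta> > 0" "x < exp (- legendre \<theta> + \<theta> * \<delta>)" "tilted_mean H \<theta> + \<delta> < g + \<epsilon>"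
    using eventually_happens[of _ "at_right (0::real)"] by auto
  \<comment> \<open>the exponential rate of the change-of-measure bound; \<open>ln 2\<close> pays for the Chebyshev factor, which is
      at least \<open>1 / 2\<close> for large \<open>n\<close>\<close>
  define c where "c = (\<lambda>n. C n - \<theta> * (T n - \<delta>) - ln 2 / real n)"
  have lim: "C \<longlonglongrightarrow> mean_cgf \<theta>" "T \<longlonglongrightarrow> tilted_mean H \<theta>"
    unfolding C_def T_def using \<theta> cgf_average tilt_average by auto
  have "(\<lambda>n. exp (c n)) \<longlonglongrightarrow> exp (mean_cgf \<theta> - \<theta> * (tilted_mean H \<theta> - \<delta>) - 0)"
    unfolding c_def by (intro tendsto_intros lim const_over_nat_tendsto_0)
  then have "eventually (\<lambda>n. x < exp (c n)) sequentially"
    by (rule order_tendstoD(1)) (use \<delta> in \<open>simp add: legendre_def algebra_simps\<close>)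
  moreover have "(\<lambda>n. T n + \<delta>) \<longlonglongrightarrow> tilted_mean H \<theta> + \<delta>"
    by (intro tendsto_intros lim)
  then have "eventually (\<lambda>n. T n + \<delta> < g + \<epsilon>) sequentially"
    by (rule order_tendstoD(2)) (rule \<delta>)
  moreover have "eventually (\<lambda>n. (1 / \<delta>\<^sup>2) / real n < 1 / 2) sequentially"
    by (rule order_tendstoD(2)[OF const_over_nat_tendsto_0]) simp
  ultimately show ?thesis
    using eventually_ge_at_top[of 1]
  proof eventually_elim
    case (elim n)
    define N where "N = nat \<lfloor>(g + \<epsilon>) * real n\<rfloor>"
    have "g \<ge> 0" using g_cdf_range by (simp add: g_def)
    then have N: "real N \<le> (g + \<epsilon>) * real n"
      using assms by (simp add: N_def)
    have "x < root n (A n k)" if k: "(g + \<epsilon>) * real n \<le> real k" for k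
    proof -
      have k': "(\<Sum>i=1..n. bern_tilt \<theta> (p i)) + \<delta> * real n \<le> real k"
      proof -
        have "(\<Sum>i=1..n. bern_tilt \<theta> (p i)) + \<delta> * real n = (T n + \<delta>) * real n"
          using elim by (simp add: T_def field_simps)
        also have "\<dots> \<le> (g + \<epsilon>) * real n"
          using elim by (intro mult_right_mono) auto
        finally show ?thesis using k by simp
      qed
      have eq: "real n * c n + ln 2 = (\<Sum>i=1..n. bern_cgf \<theta> (p i))
          - \<theta> * ((\<Sum>i=1..n. bern_tilt \<theta> (p i)) - \<delta> * real n)"
        using elim by (simp add: c_def C_def T_def field_simps)
      have "exp (real n * c n) = exp (real n * c n + ln 2) * (1 / 2)"
        by (simp add: exp_add)
      also have "\<dots> \<le> exp (real n * c n + ln 2) * (1 - 1 / (\<delta>\<^sup>2 * real n))"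
        using elim by (intro mult_left_mono) auto
      also have "\<dots> \<le> A n k"
        unfolding eq using \<theta> \<delta> elim range by (intro break_pt_lower k') auto
      finally have "root n (exp (real n * c n)) \<le> root n (A n k)"
        using elim by simp
      then show ?thesis using elim by (simp add: root_exp_mult)
    qed
    then have "real k < (g + \<epsilon>) * real n" if "root n (A n k) \<le> x" for k
      using that by (metis not_less)
    then have "k \<le> N" if "root n (A n k) \<le> x" for k
      unfolding N_def using that by (intro le_nat_floor less_imp_le) blast
    then have "{k \<in> {1..n}. root n (A n k) \<le> x} \<subseteq> {1..N}"
      by auto
    then have "card {k \<in> {1..n}. root n (A n k) \<le> x} \<le> N"
      using card_mono[of "{1..N}"] by fastforce
    then have "real (card {k \<in> {1..n}. root n (A n k) \<le> x}) \<le> (g + \<epsilon>) * real n"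
      using N by linarith
    then show ?case
      using elim by (subst cdf_emp_transformed) (auto simp: field_simps g_def)
  qed
qed

text \<open>
  For large \<open>n\<close>, all \<open>k\<close> up to \<open>(g_cdf H x - \<epsilon> / 2) n\<close> have transformed break point at most \<open>x\<close>,
  by the Markov bound. The other half of \<open>\<epsilon>\<close> pays for rounding the number of these \<open>k\<close> to an integer.
\<close>

lemma empirical_cdf_lower:
  assumes "0 < x" "x < 1" "\<epsilon> > 0"
  shows "eventually (\<lambda>n. g_cdf H x - \<epsilon> \<le> G n x) sequentially"
proof -
  define b where "b = g_cdf H x - \<epsilon> / 2"
  obtain \<theta> where \<theta>: "\<theta> \<in> \<rat>" "\<theta> < 0" "mean_cgf \<theta> - \<theta> * b < ln x"
    using chernoff_exponent_below[of x "\<epsilon> / 2"] assms unfolding b_def by auto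
  define c where "c = (\<lambda>n. (\<Sum>i=1..n. bern_cgf \<theta> (p i)) / real n - \<theta> * b)"
  have "c \<longlonglongrightarrow> mean_cgf \<theta> - \<theta> * b"
    unfolding c_def by (intro tendsto_intros cgf_average \<theta>)
  then have "eventually (\<lambda>n. c n < ln x) sequentially"
    by (rule order_tendstoD(2)) (rule \<theta>)
  moreover have "eventually (\<lambda>n. 1 / real n < \<epsilon> / 2) sequentially"
    by (rule order_tendstoD(2)[OF const_over_nat_tendsto_0]) (use assms in simp)
  ultimately show ?thesis
    using eventually_ge_at_top[of 1]
  proof eventually_elim
    case (elim n)
    define N where "N = nat \<lfloor>b * real n\<rfloor>"
    have "b \<le> 1" using g_cdf_range[of x] assms by (simp add: b_def)
    then have "b * real n \<le> 1 * real n" by (intro mult_right_mono) auto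
    then have Nn: "N \<le> n" unfolding N_def by linarith
    have small: "root n (A n k) \<le> x" if k: "k \<in> {1..N}" for k
    proof -
      have "real k \<le> b * real n"
        using k unfolding N_def atLeastAtMost_iff by linarith
      then have "- \<theta> * real k \<le> - \<theta> * (b * real n)"
        using \<theta> by (intro mult_left_mono) auto
      moreover have "real n * c n = (\<Sum>i=1..n. bern_cgf \<theta> (p i)) - \<theta> * (b * real n)"
        using elim by (simp add: c_def field_simps)
      ultimately have "(\<Sum>i=1..n. bern_cgf \<theta> (p i)) - \<theta> * real k \<le> real n * c n"
        by simp
      then have "exp ((\<Sum>i=1..n. bern_cgf \<theta> (p i)) - \<theta> * real k) \<le> exp (real n * c n)"
        by simp
      with break_pt_upper[of n p \<theta> k] have "A n k \<le> exp (real n * c n)"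
        using range \<theta> by (meson atLeastAtMost_iff less_imp_le order_trans)
      then have "root n (A n k) \<le> root n (exp (real n * c n))"
        using elim by simp
      also have "\<dots> = exp (c n)" using elim by (simp add: root_exp_mult)
      also have "\<dots> \<le> x" using elim assms by (metis exp_ln exp_le_cancel_iff less_imp_le)
      finally show ?thesis .
    qed
    have "{1..N} \<subseteq> {k \<in> {1..n}. root n (A n k) \<le> x}"
      using Nn small by auto
    then have "card {1..N} \<le> card {k \<in> {1..n}. root n (A n k) \<le> x}"
      by (intro card_mono) auto
    moreover have "b * real n - 1 \<le> real N"
      unfolding N_def by linarith
    moreover have "1 \<le> \<epsilon> / 2 * real n"
      using elim by (simp add: field_simps)
    ultimately have "(g_cdf H x - \<epsilon>) * real n \<le> real (card {k \<in> {1..n}. root n (A n k) \<le> x})"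
      by (simp add: b_def algebra_simps)
    then show ?case
      using elim by (subst cdf_emp_transformed) (auto simp: field_simps)
  qed
qed

lemma empirical_weak_conv: "weak_conv_m (emp_transformed (\<lambda>n k. p n)) (g_tilde H)"
  unfolding weak_conv_m_def weak_conv_def cdf_g_tilde
proof (intro allI impI)
  fix x assume cont: "isCont (g_cdf H) x"
  have root_range: "root n (A n k) \<in> {0..1}" if "n \<ge> 1" for n k
    using break_pt_range[of p n k, OF range] that by auto
  consider "x < 0" | "0 \<le> x" "x < 1" | "1 \<le> x" by linarith
  then show "(\<lambda>n. G n x) \<longlonglongrightarrow> g_cdf H x"
  proof cases
    case 1
    have "G n x = g_cdf H x" if "n \<ge> 1" for n
    proof -
      have "\<not> root n (A n k) \<le> x" for k
        using root_range[OF that, of k] 1 by simp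
      then have none: "{k \<in> {1..n}. root n (A n k) \<le> x} = {}"
        by simp
      show ?thesis
        using 1 unfolding cdf_emp_transformed[OF that] none by (simp add: g_cdf_def)
    qed
    then show ?thesis
      by (intro tendsto_eventually eventually_sequentiallyI[of 1]) auto
  next
    case 3
    have "G n x = g_cdf H x" if "n \<ge> 1" for n
    proof -
      have "root n (A n k) \<le> x" for k
        using root_range[OF that, of k] 3 by simp
      then have all: "{k \<in> {1..n}. root n (A n k) \<le> x} = {1..n}"
        by auto
      show ?thesis
        using 3 that unfolding cdf_emp_transformed[OF that] all by (simp add: g_cdf_ge_1)
    qed
    then show ?thesis
      by (intro tendsto_eventually eventually_sequentiallyI[of 1]) auto
  next
    case 2
    have lower: "eventually (\<lambda>n. g_cdf H x - \<epsilon> \<le> G n x) sequentially" if "\<epsilon> > 0" for \<epsilon>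
    proof (cases "x = 0")
      case True
      \<comment> \<open>at 0 the limit distribution function is continuous only if it vanishes there, so that the lower
          bound is trivial\<close>
      have "(g_cdf H \<longlongrightarrow> g_cdf H 0) (at_left 0)"
        using cont True unfolding isCont_def by (simp add: filterlim_at_split)
      moreover have "(g_cdf H \<longlongrightarrow> 0) (at_left 0)"
        by (rule tendsto_eventually) (auto simp: eventually_at_left_field g_cdf_def intro: exI[of _ "-1"])
      ultimately have "g_cdf H 0 = 0"
        using tendsto_unique[of "at_left (0::real)"] by auto
      moreover have "- \<epsilon> \<le> G n 0" for n
        using that measure_nonneg[of "emp_transformed (\<lambda>n k. p n) n" "{..0}"]
        unfolding cdf_def by linarith
      ultimately show ?thesis using True by simp
    next
      case False
      then show ?thesis using empirical_cdf_lower 2 that by simp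
    qed
    show ?thesis
    proof (rule tendstoI)
      fix e :: real assume "e > 0"
      then have "eventually (\<lambda>n. G n x \<le> g_cdf H x + e / 2) sequentially"
          "eventually (\<lambda>n. g_cdf H x - e / 2 \<le> G n x) sequentially"
        using empirical_cdf_upper[of x "e / 2"] lower[of "e / 2"] 2 by auto
      then show "eventually (\<lambda>n. dist (G n x) (g_cdf H x) < e) sequentially"
        by eventually_elim (use \<open>e > 0\<close> in \<open>auto simp: dist_real_def abs_less_iff\<close>)
    qed
  qed
qed

end

section \<open>Almost sure convergence\<close>

theorem theorem4p12:
  fixes M :: "'a measure" and P :: "nat \<Rightarrow> 'a \<Rightarrow> real" and H :: "real measure"
  assumes "prob_space M"
    and range: "\<And>n \<omega>. n \<ge> 1 \<Longrightarrow> \<omega> \<in> space M \<Longrightarrow> P n \<omega> \<in> {0..1}"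
    and indep: "prob_space.indep_vars M (\<lambda>_. borel) P {1..}"
    and ident: "\<And>n. n \<ge> 1 \<Longrightarrow> distr M borel (P n) = H"
    and nondeg: "measure H {0, 1} < 1"
  shows "prob_space (g_tilde H) \<and> measure (g_tilde H) {0..1} = 1 \<and>
    (AE \<omega> in M. weak_conv_m (\<lambda>n. emp_transformed (\<lambda>n k. P n \<omega>) n) (g_tilde H))"
proof -
  interpret M: prob_space M by fact
  have rv: "P 1 \<in> borel_measurable M"
    using indep unfolding M.indep_vars_def by auto
  have H: "H = distr M borel (P 1)" using ident by simp
  interpret proportion_law H
  proof (intro proportion_law.intro proportion_law_axioms.intro)
    show "prob_space H" unfolding H using rv by (rule M.prob_space_distr)
    show "sets H = sets borel" by (simp add: H)
    show "AE t in H. t \<in> {0..1}"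
      unfolding H using rv range[of 1] by (subst AE_distr_iff) auto
  qed (rule nondeg)
  interpret G: real_distribution "g_tilde H" by (rule real_distribution_g_tilde)
  have "AE \<omega> in M. \<forall>\<theta>\<in>\<rat>.
      (\<lambda>n. (\<Sum>i=1..n. bern_cgf \<theta> (P i \<omega>)) / real n) \<longlonglongrightarrow> mean_cgf \<theta>"
    unfolding AE_ball_countable[OF countable_rat] mean_cgf_def
    by (intro ballI M.iid_average_bounded[OF range indep ident bern_cgf_measurable bern_cgf_bound])
  moreover have "AE \<omega> in M. \<forall>\<theta>\<in>\<rat>.
      (\<lambda>n. (\<Sum>i=1..n. bern_tilt \<theta> (P i \<omega>)) / real n) \<longlonglongrightarrow> tilted_mean H \<theta>"
    unfolding AE_ball_countable[OF countable_rat] tilted_mean_eq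
    by (intro ballI M.iid_average_bounded[OF range indep ident bern_tilt_measurable bern_tilt_bound])
  ultimately have "AE \<omega> in M. weak_conv_m (emp_transformed (\<lambda>n k. P n \<omega>)) (g_tilde H)"
    using AE_space
  proof eventually_elim
    case (elim \<omega>)
    interpret typical_proportions H "\<lambda>n. P n \<omega>"
      by unfold_locales (use elim range in auto)
    show ?case by (rule empirical_weak_conv)
  qed
  then show ?thesis
    using G.prob_space_axioms g_tilde_unit_interval by simp
qed

end
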